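(* Let $M\subset\mathbb C$ be closed, unbounded, and of planar Lebesgue measure zero. Let $A\subseteq M$ be countable and dense in $M$, and let $B\subset\mathbb C$ be countable and dense in $\mathbb C$. There exists a transcendental entire function $f$ such that $f|_A\colon A\to B$ is bijective and $f^{-1}(B)\cap M=A$. Moreover, the set of such functions has the cardinality of the continuum.
   Context: A transcendental entire function is an entire function $f\colon\mathbb C\to\mathbb C$ that is not a polynomial. Density of $A$ in $M$ is with respect to the subspace topology on $M$. *)

theory Defs
  imports
    "HOL-Complex_Analysis.Complex_Analysis"
    "HOL-Computational_Algebra.Polynomial"
    "HOL-Library.Equipollence"
begin

definition transcendental_entire :: "(complex \<Rightarrow> complex) \<Rightarrow> bool" where
  "transcendental_entire f \<longleftrightarrow> f holomorphic_on UNIV \<and> \<not> (\<exists>p :: complex poly. f = poly p)"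

definition dense_in :: "'a topology \<Rightarrow> 'a set \<Rightarrow> bool" where
  "dense_in X S \<longleftrightarrow> S \<subseteq> topspace X \<and> X closure_of S = topspace X"

end

(* The function is a locally uniform limit of entire functions built by a back-and-forth
   construction: each step moves one more point of A into B or gives one more point of B a preimage
   in A, by adding a small multiple of a polynomial vanishing at the points already treated.  As M
   is a null set, a further generic perturbation keeps M away from the values already used, except
   at their designated preimages; having these as simple preimages makes that property stable under
   the later, sufficiently small corrections.  All corrections also vanish at one point p outside M,
   so f(p) is prescribed arbitrarily, which yields continuum many functions.  A polynomial cannot
   occur: its image of M would be closed, dense and null. *)

theory Submission
  imports Defs
begin

section \<open>Continuous functions and cardinality\<close>

text \<open>A continuous function is determined by the pairs \<open>(d, U)\<close> with
  \<open>f d\<close> in \<open>U\<close>, where \<open>d\<close> runs through a countable dense set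
  and \<open>U\<close> through a countable base. This codes functions injectively by subsets of a
  countable set.\<close>

lemma continuous_functions_lepoll_nat_sets:
  "{f :: 'a::second_countable_topology \<Rightarrow> 'b::{second_countable_topology,t2_space}. continuous_on UNIV f}
    \<lesssim> (UNIV :: nat set set)"
proof -
  obtain D :: "'a set" where D: "countable D" "\<And>X. open X \<Longrightarrow> X \<noteq> {} \<Longrightarrow> \<exists>d\<in>D. d \<in> X"
    using countable_dense_setE by metis
  obtain \<B> :: "'b set set" where \<B>: "countable \<B>" "topological_basis \<B>"
    using ex_countable_basis by blast
  define code where "code f = {(d, U). d \<in> D \<and> U \<in> \<B> \<and> f d \<in> U}" for f :: "'a \<Rightarrow> 'b"
  have "inj_on code {f. continuous_on UNIV f}"
  proof (rule inj_onI, rule ext, rule ccontr)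
    fix f g :: "'a \<Rightarrow> 'b" and x
    assume f: "f \<in> {f. continuous_on UNIV f}" and g: "g \<in> {f. continuous_on UNIV f}"
      and eq: "code f = code g" and "f x \<noteq> g x"
    then have "open {x. f x \<noteq> g x}" "{x. f x \<noteq> g x} \<noteq> {}"
      by (auto intro: open_Collect_neq)
    then obtain d where d: "d \<in> D" "f d \<noteq> g d"
      using D(2) by blast
    then obtain V where "open V" "f d \<in> V" "g d \<notin> V"
      using hausdorff by blast
    then obtain U where "U \<in> \<B>" "f d \<in> U" "g d \<notin> U"
      by (metis \<B>(2) subsetD topological_basisE)
    then have "(d, U) \<in> code f" "(d, U) \<notin> code g"
      using d by (auto simp: code_def)
    with eq show False by simp
  qed
  moreover have "code ` {f. continuous_on UNIV f} \<subseteq> Pow (D \<times> \<B>)"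
    by (auto simp: code_def)
  ultimately have "{f :: 'a \<Rightarrow> 'b. continuous_on UNIV f} \<lesssim> Pow (D \<times> \<B>)"
    unfolding lepoll_def by blast
  also have "Pow (D \<times> \<B>) \<lesssim> (UNIV :: nat set set)"
  proof -
    have "inj_on (image (to_nat_on (D \<times> \<B>))) (Pow (D \<times> \<B>))"
      using D(1) \<B>(1) by (intro inj_on_image_Pow inj_on_to_nat_on) auto
    then show ?thesis unfolding lepoll_def by blast
  qed
  finally show ?thesis .
qed

section \<open>Perturbing entire functions\<close>

lemma deriv_prod_linear_nonzero:
  fixes S :: "complex set"
  assumes "finite S" "a \<in> S"
  shows "deriv (\<lambda>z. \<Prod>s\<in>S. z - s) a \<noteq> 0"
proof -
  have "(\<lambda>z. \<Prod>s\<in>S. z - s) = (\<lambda>z. (z - a) * (\<Prod>s\<in>S - {a}. z - s))"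
    using assms by (simp add: prod.remove)
  moreover have "((\<lambda>z. (z - a) * (\<Prod>s\<in>S - {a}. z - s)) has_field_derivative
      (\<Prod>s\<in>S - {a}. a - s)) (at a)"
  proof -
    have "(\<lambda>z. \<Prod>s\<in>S - {a}. z - s) holomorphic_on UNIV"
      by (intro holomorphic_intros)
    then have "((\<lambda>z. \<Prod>s\<in>S - {a}. z - s) has_field_derivative
        deriv (\<lambda>z. \<Prod>s\<in>S - {a}. z - s) a) (at a)"
      by (rule holomorphic_derivI) auto
    from DERIV_mult[OF DERIV_diff[OF DERIV_ident DERIV_const[of a]] this] show ?thesis
      by simp
  qed
  ultimately show ?thesis
    using assms(1) by (auto simp: DERIV_imp_deriv)
qed

text \<open>Supplies the factors of all corrections: the zeros freeze the values already fixed, and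
  the bound \<open>C\<close> on a disc tells how small a coefficient must be. The product of the
  linear factors does it.\<close>

lemma entire_function_with_simple_zeros:
  fixes S :: "complex set"
  assumes "finite S"
  obtains P C where "P holomorphic_on UNIV" "\<And>z. P z = 0 \<longleftrightarrow> z \<in> S" "\<And>z. z \<in> S \<Longrightarrow> deriv P z \<noteq> 0"
    "C > 0" "\<And>z. z \<in> cball 0 R \<Longrightarrow> norm (P z) \<le> C"
proof -
  define P where "P = (\<lambda>z. \<Prod>s\<in>S. z - s)"
  have P: "P holomorphic_on UNIV"
    unfolding P_def by (intro holomorphic_intros)
  have "bounded (P ` cball 0 R)"
    by (intro compact_imp_bounded compact_continuous_image compact_cball
        holomorphic_on_imp_continuous_on holomorphic_on_subset[OF P]) auto
  then obtain C where "C > 0" "\<And>z. z \<in> cball 0 R \<Longrightarrow> norm (P z) \<le> C"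
    by (auto simp: bounded_pos)
  moreover have "P z = 0 \<longleftrightarrow> z \<in> S" for z
    using assms by (auto simp: P_def)
  moreover have "deriv P z \<noteq> 0" if "z \<in> S" for z
    unfolding P_def using assms that by (rule deriv_prod_linear_nonzero)
  ultimately show thesis using P that by blast
qed

text \<open>For fixed \<open>z\<close> with \<open>Q z \<noteq> 0\<close> the equation \<open>f z + c * Q z = b\<close> determines \<open>c\<close>, so
  the parameters \<open>c\<close> for which it is solvable in \<open>M\<close> form the image of a null set
  under a differentiable map.\<close>

lemma generic_perturbation:
  fixes f Q :: "complex \<Rightarrow> complex"
  assumes M: "negligible M"
    and f: "f holomorphic_on UNIV" and Q: "Q holomorphic_on UNIV"
    and F: "finite F" "\<And>a b. (a, b) \<in> F \<Longrightarrow> f a = b" "inj_on snd F"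
    and Q0: "\<And>z. z \<in> M \<Longrightarrow> Q z = 0 \<Longrightarrow> z \<in> fst ` F"
    and Q1: "\<And>a. a \<in> fst ` F \<Longrightarrow> Q a = 0 \<and> deriv Q a \<noteq> 0"
    and "\<delta> > 0"
  obtains c where "norm c < \<delta>"
    "\<forall>(a, b)\<in>F. deriv (\<lambda>z. f z + c * Q z) a \<noteq> 0 \<and> (\<forall>z\<in>M. f z + c * Q z = b \<longrightarrow> z = a)"
proof -
  \<comment> \<open>The exceptional parameters: \<open>bad1\<close> holds the finitely many
    \<open>c\<close> for which the derivative vanishes at some designated preimage,
    \<open>bad2\<close> those for which a value \<open>b\<close> is attained on \<open>M\<close>
    away from the designated points. A ball is not null, so some small \<open>c\<close> avoids
    both.\<close>
  define bad1 where "bad1 = (\<lambda>(a, b). - deriv f a / deriv Q a) ` F"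
  define bad2 where "bad2 = (\<Union>(a, b)\<in>F. (\<lambda>z. (b - f z) / Q z) ` (M - fst ` F))"
  have "negligible ((\<lambda>z. (b - f z) / Q z) ` (M - fst ` F))" for b
  proof (rule negligible_differentiable_image_negligible)
    show "negligible (M - fst ` F)"
      using M by (rule negligible_subset) auto
    have "(\<lambda>z. (b - f z) / Q z) holomorphic_on {z. Q z \<noteq> 0}"
      by (intro holomorphic_intros holomorphic_on_subset[OF f] holomorphic_on_subset[OF Q]) auto
    moreover have "open {z. Q z \<noteq> 0}"
      using Q by (intro open_Collect_neq holomorphic_on_imp_continuous_on continuous_on_const)
    ultimately have "(\<lambda>z. (b - f z) / Q z) differentiable (at z)" if "Q z \<noteq> 0" for z
      using that by (meson field_differentiable_imp_differentiable holomorphic_on_imp_differentiable_at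
          mem_Collect_eq)
    then show "(\<lambda>z. (b - f z) / Q z) differentiable_on (M - fst ` F)"
      using Q0 by (auto simp: differentiable_on_def intro: differentiable_at_withinI)
  qed auto
  then have "negligible bad2"
    unfolding bad2_def using F(1) by (intro negligible_Union) auto
  moreover have "negligible bad1"
    unfolding bad1_def using F(1) by (intro negligible_finite) auto
  ultimately have "negligible (bad1 \<union> bad2)" by simp
  moreover have "\<not> negligible (ball (0::complex) \<delta>)"
    using \<open>\<delta> > 0\<close> by (intro open_not_negligible) auto
  ultimately obtain c where c: "c \<in> ball 0 \<delta>" "c \<notin> bad1" "c \<notin> bad2"
    using negligible_subset by blast
  have "deriv (\<lambda>z. f z + c * Q z) a \<noteq> 0" if ab: "(a, b) \<in> F" for a b
  proof -
    have "(f has_field_derivative deriv f a) (at a)" "(Q has_field_derivative deriv Q a) (at a)"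
      using f Q by (auto intro: holomorphic_derivI)
    then have "((\<lambda>z. f z + c * Q z) has_field_derivative deriv f a + c * deriv Q a) (at a)"
      by (auto intro!: derivative_eq_intros)
    moreover have "deriv f a + c * deriv Q a \<noteq> 0"
    proof
      assume "deriv f a + c * deriv Q a = 0"
      moreover have "deriv Q a \<noteq> 0"
        using Q1 ab by force
      ultimately have "c = - deriv f a / deriv Q a"
        by (simp add: field_simps add_eq_0_iff)
      then show False
        using c(2) ab unfolding bad1_def by force
    qed
    ultimately show "deriv (\<lambda>z. f z + c * Q z) a \<noteq> 0"
      by (simp add: DERIV_imp_deriv)
  qed
  moreover have "z = a" if ab: "(a, b) \<in> F" and z: "z \<in> M" "f z + c * Q z = b" for a b z
  proof (cases "z \<in> fst ` F")
    case True
    \<comment> \<open>At a designated point \<open>Q\<close> vanishes, so the perturbation changes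
      nothing there and injectivity of \<open>snd\<close> on \<open>F\<close> decides.\<close>
    then have "f z = b" using z Q1 by auto
    then have "(z, b) \<in> F" using True F(2) by force
    then show ?thesis using inj_onD[OF F(3), of "(z, b)" "(a, b)"] ab by simp
  next
    case False
    then have "Q z \<noteq> 0" using Q0 z by blast
    then have "c = (b - f z) / Q z" using z by (auto simp: field_simps)
    then have "c \<in> bad2" unfolding bad2_def using ab z False by force
    then show ?thesis using c by simp
  qed
  ultimately have "\<forall>(a, b)\<in>F. deriv (\<lambda>z. f z + c * Q z) a \<noteq> 0 \<and> (\<forall>z\<in>M. f z + c * Q z = b \<longrightarrow> z = a)"
    by blast
  then show thesis
    using c(1) by (intro that) simp_all
qed

text \<open>The quotient \<open>(f z - f a) / (z - a)\<close> has no zeros on \<open>K\<close>, and by the maximum principle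
  it depends continuously on \<open>f\<close>.\<close>

lemma simple_value_persistent:
  fixes f :: "complex \<Rightarrow> complex"
  assumes f: "f holomorphic_on UNIV" and "deriv f a \<noteq> 0" and K: "compact K"
    and a: "\<And>z. z \<in> K \<Longrightarrow> f z = f a \<Longrightarrow> z = a"
  shows "\<forall>\<^sub>F \<epsilon> in at_right 0. \<forall>g. g holomorphic_on UNIV \<longrightarrow> g a = f a \<longrightarrow>
    (\<forall>z \<in> K \<union> cball a 1. norm (g z - f z) \<le> \<epsilon>) \<longrightarrow> (\<forall>z\<in>K. g z = f a \<longrightarrow> z = a)"
proof -
  \<comment> \<open>The divided difference of \<open>h\<close> at \<open>a\<close> with its
    removable singularity filled in; hence it is entire whenever \<open>h\<close> is.\<close>
  define quot where "quot h z = (if z = a then deriv h a else (h z - h a) / (z - a))"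
    for h :: "complex \<Rightarrow> complex" and z
  have quot: "quot h holomorphic_on UNIV" if "h holomorphic_on UNIV" for h
    using pole_lemma_open[OF that open_UNIV, of a] unfolding quot_def .
  obtain m where m: "m > 0" "\<And>z. z \<in> K \<Longrightarrow> m \<le> norm (quot f z)"
  proof (cases "K = {}")
    case True
    then show ?thesis using that[of 1] by simp
  next
    case False
    have "continuous_on K (\<lambda>z. norm (quot f z))"
      by (intro continuous_intros holomorphic_on_imp_continuous_on
          holomorphic_on_subset[OF quot[OF f]]) auto
    from continuous_attains_inf[OF K False this] obtain x
      where x: "x \<in> K" "\<And>z. z \<in> K \<Longrightarrow> norm (quot f x) \<le> norm (quot f z)" by blast
    moreover have "quot f x \<noteq> 0"
      using assms(2) a x(1) by (auto simp: quot_def)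
    ultimately show ?thesis using that[of "norm (quot f x)"] by simp
  qed
  have "z = a" if \<epsilon>: "\<epsilon> < m" and g: "g holomorphic_on UNIV" "g a = f a"
    "\<And>z. z \<in> K \<union> cball a 1 \<Longrightarrow> norm (g z - f z) \<le> \<epsilon>" and z: "z \<in> K" "g z = f a" for \<epsilon> g z
  proof (rule ccontr)
    assume "z \<noteq> a"
    define h where "h = (\<lambda>z. g z - f z)"
    have h: "h holomorphic_on UNIV" unfolding h_def by (intro holomorphic_intros f g)
    \<comment> \<open>Close to \<open>a\<close> the small denominator spoils a direct estimate. On
      the unit circle about \<open>a\<close> the denominator has modulus 1, and the maximum
      principle carries the bound inwards; this is why closeness is also assumed on
      \<open>cball a 1\<close>.\<close>
    have "norm (quot h z) \<le> \<epsilon>"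
    proof (cases "norm (z - a) < 1")
      case True
      show ?thesis
      proof (rule maximum_modulus_frontier[where f = "quot h" and S = "ball a 1" and \<xi> = z])
        show "quot h holomorphic_on interior (ball a 1)"
          using quot[OF h] holomorphic_on_subset by blast
        show "continuous_on (closure (ball a 1)) (quot h)"
          using quot[OF h] by (meson holomorphic_on_imp_continuous_on holomorphic_on_subset subset_UNIV)
        fix y assume "y \<in> frontier (ball a 1)"
        then have y: "dist a y = 1" by (simp add: frontier_ball)
        then have "norm (y - a) = 1" "y \<noteq> a" by (auto simp: dist_norm norm_minus_commute)
        moreover have "norm (g y - f y) \<le> \<epsilon>" using y g(3) by simp
        ultimately show "norm (quot h y) \<le> \<epsilon>"
          using g(2) by (simp add: quot_def h_def norm_divide)
      qed (use True in \<open>auto simp: dist_norm norm_minus_commute\<close>)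
    next
      case False
      have "norm (g z - f z) \<le> \<epsilon>" by (rule g(3)) (use z in simp)
      moreover have "norm (g z - f z) / norm (z - a) \<le> norm (g z - f z) / 1"
        using False by (intro divide_left_mono) auto
      ultimately show ?thesis
        using \<open>z \<noteq> a\<close> g(2) by (simp add: quot_def h_def norm_divide)
    qed
    \<comment> \<open>At a second solution \<open>z\<close> the two quotients differ only in sign,
      so the lower bound \<open>m\<close> for one contradicts the upper bound \<epsilon> <
      \<open>m\<close> for the other.\<close>
    moreover have "quot h z = - quot f z"
      using \<open>z \<noteq> a\<close> z g(2) by (simp add: quot_def h_def field_simps)
    ultimately show False using m(2)[OF z(1)] \<epsilon> by simp
  qed
  then show ?thesis
    unfolding eventually_at_right_field using m(1) by blast
qed

text \<open>A nonconstant polynomial is proper, so it maps the closed set \<open>M\<close> onto a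
  closed set; containing the dense set \<open>B\<close>, this image is the whole plane, although a
  differentiable image of a null set is null. A constant has only one value, which is not
  dense.\<close>

lemma polynomial_image_negligible_not_dense:
  fixes p :: "complex poly"
  assumes M: "closed M" "negligible M" and B: "closure B = UNIV" "B \<subseteq> poly p ` M"
  shows False
proof (cases "degree p = 0")
  case True
  then obtain c where "p = [:c:]" by (meson degree_eq_zeroE)
  then have "B \<subseteq> {c}" using B(2) by auto
  then have "closure B \<subseteq> {c}" by (simp add: closure_minimal)
  then have "finite (UNIV :: complex set)" using B(1) finite_subset by auto
  then show False by (simp add: infinite_UNIV_char_0)
next
  case False
  have proper: "compact (poly p -` K)" if "compact K" for K
  proof -
    have "poly p = (\<lambda>z. \<Sum>i\<le>degree p. coeff p i * z ^ i)"
      by (auto simp: poly_altdef)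
    moreover have "p \<noteq> 0" using False by auto
    ultimately show ?thesis
      using proper_map_polyfun_univ[of K "coeff p" "degree p" "degree p"] that False
      by (auto simp: vimage_def)
  qed
  have "w \<in> poly p ` M" for w
  proof -
    \<comment> \<open>Closedness of the image is checked near \<open>w\<close>: by properness only a
      compact part of \<open>M\<close> is mapped into the disc, and its compact image contains every
      point of \<open>B\<close> in the open disc.\<close>
    define C where "C = poly p ` (M \<inter> poly p -` cball w 1)"
    have "compact C"
      unfolding C_def
      by (intro compact_continuous_image closed_Int_compact M proper continuous_intros compact_cball)
    moreover have "ball w 1 \<inter> B \<subseteq> C"
      using B(2) by (force simp: C_def)
    ultimately have "closure (ball w 1 \<inter> B) \<subseteq> C"
      by (simp add: closure_minimal compact_imp_closed)
    moreover have "w \<in> closure (ball w 1 \<inter> B)"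
      using open_Int_closure_subset[of "ball w 1" B] B(1) by auto
    ultimately show ?thesis by (auto simp: C_def)
  qed
  then have "poly p ` M = UNIV" by blast
  moreover have "negligible (poly p ` M)"
  proof (rule negligible_differentiable_image_negligible)
    show "poly p differentiable_on M"
      by (meson differentiable_at_withinI differentiable_on_def field_differentiable_def
          field_differentiable_imp_differentiable poly_DERIV)
  qed (use M in auto)
  ultimately show False by simp
qed

section \<open>Back and forth\<close>

locale back_and_forth =
  fixes M A B :: "complex set" and p w :: complex
  assumes closed_M: "closed M" and negligible_M: "negligible M"
    and A: "A \<subseteq> M" "countable A" "\<not> bounded A"
    and B: "countable B" "closure B = UNIV"
    and p: "p \<notin> M"
begin

text \<open>\<open>F\<close> is the finite part of the bijection settled so far. Nonzero derivatives
  and uniqueness within \<open>M\<close> are carried along because together they withstand small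
  perturbations on compact parts of \<open>M\<close>.\<close>

definition partial_matching :: "(complex \<Rightarrow> complex) \<Rightarrow> (complex \<times> complex) set \<Rightarrow> bool" where
  "partial_matching f F \<longleftrightarrow> f holomorphic_on UNIV \<and> f p = w \<and> finite F \<and> F \<subseteq> A \<times> B \<and>
    (\<forall>(a, b)\<in>F. f a = b \<and> deriv f a \<noteq> 0 \<and> (\<forall>z\<in>M. f z = b \<longrightarrow> z = a))"

text \<open>Injectivity of the finite relation \<open>F\<close> follows from the uniqueness clause, as \<open>A \<subseteq> M\<close>.\<close>

lemma partial_matchingD:
  assumes "partial_matching f F" "(a, b) \<in> F"
  shows "f a = b" "a \<in> A" "b \<in> B" "deriv f a \<noteq> 0" "\<And>z. z \<in> M \<Longrightarrow> f z = b \<Longrightarrow> z = a"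
  using assms unfolding partial_matching_def by auto

lemma dense_avoiding_finite:
  assumes "finite T" "r > 0"
  obtains b where "b \<in> B" "b \<notin> T" "dist x b < r"
proof -
  have "infinite (ball x r)"
    using assms(2) uncountable_ball countable_finite by blast
  then have "ball x r - T \<noteq> {}"
    using assms(1) by (metis finite.emptyI finite_Diff2)
  moreover have "open (ball x r - T)"
    using assms(1) by (intro open_Diff finite_imp_closed) auto
  ultimately have "(ball x r - T) \<inter> B \<noteq> {}"
    using B(2) open_Int_closure_eq_empty[of "ball x r - T" B] by auto
  then show thesis using that by auto
qed

text \<open>The common last step of both directions. The correction \<open>h\<close> gives
  \<open>a\<close> the value \<open>b\<close> but may spoil simplicity or create further preimages
  in \<open>M\<close>; a generic multiple of some \<open>Q\<close> vanishing at \<open>p\<close> and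
  at all matched points repairs this.\<close>

lemma partial_matching_extend:
  assumes F: "partial_matching f F" and ab: "a \<in> A" "b \<in> B" "a \<notin> fst ` F" "b \<notin> snd ` F"
    and h: "h holomorphic_on UNIV" "\<And>z. z \<in> insert p (fst ` F) \<Longrightarrow> h z = 0" "f a + h a = b"
    and "\<eta> > 0"
  obtains f' where "partial_matching f' (insert (a, b) F)"
    "\<And>z. z \<in> cball 0 R \<Longrightarrow> norm (f' z - (f z + h z)) \<le> \<eta>"
proof -
  define F' where "F' = insert (a, b) F"
  have fin: "finite F'" and f: "f holomorphic_on UNIV" and F'_sub: "F' \<subseteq> A \<times> B"
    using F ab by (auto simp: partial_matching_def F'_def)
  \<comment> \<open>The zero at \<open>p\<close> preserves \<open>f p = w\<close>; since
    \<open>p\<close> is outside \<open>M\<close>, it adds no zero of \<open>Q\<close> in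
    \<open>M\<close> beyond the matched points.\<close>
  obtain Q C where Q: "Q holomorphic_on UNIV" and Q0: "\<And>z. Q z = 0 \<longleftrightarrow> z \<in> insert p (fst ` F')"
    and Q1: "\<And>z. z \<in> insert p (fst ` F') \<Longrightarrow> deriv Q z \<noteq> 0"
    and C: "C > 0" "\<And>z. z \<in> cball 0 R \<Longrightarrow> norm (Q z) \<le> C"
    using entire_function_with_simple_zeros[of "insert p (fst ` F')" R] fin by auto
  have interp: "f x + h x = y" if "(x, y) \<in> F'" for x y
  proof (cases "(x, y) = (a, b)")
    case False
    then have "(x, y) \<in> F" using that by (auto simp: F'_def)
    moreover from this have "h x = 0" by (intro h(2)) force
    ultimately show ?thesis using partial_matchingD(1)[OF F] by simp
  qed (use h(3) in simp)
  have "inj_on snd F"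
  proof (rule inj_onI)
    fix u v assume "u \<in> F" "v \<in> F" "snd u = snd v"
    then have "(fst u, snd u) \<in> F" "(fst v, snd u) \<in> F" by (metis prod.collapse)+
    then have "fst v \<in> M" "f (fst v) = snd u" "fst v = fst u"
      using partial_matchingD[OF F] A(1) by blast+
    then show "u = v" using \<open>snd u = snd v\<close> by (simp add: prod_eq_iff)
  qed
  then have inj: "inj_on snd F'"
    using ab(4) by (auto simp: F'_def)
  have zero_M: "z \<in> fst ` F'" if "z \<in> M" "Q z = 0" for z
    using that p Q0 by auto
  have simple: "Q x = 0 \<and> deriv Q x \<noteq> 0" if "x \<in> fst ` F'" for x
    using that Q0 Q1 by simp
  have "\<eta> / C > 0" using \<open>\<eta> > 0\<close> C(1) by simp
  then obtain c where c: "norm c < \<eta> / C"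
    "\<forall>(x, y)\<in>F'. deriv (\<lambda>z. f z + h z + c * Q z) x \<noteq> 0 \<and>
      (\<forall>z\<in>M. f z + h z + c * Q z = y \<longrightarrow> z = x)"
    using generic_perturbation[OF negligible_M holomorphic_on_add[OF f h(1)] Q fin interp inj
      zero_M simple] by blast
  define f' where "f' = (\<lambda>z. f z + h z + c * Q z)"
  have "f' x = y" if "(x, y) \<in> F'" for x y
  proof -
    have "Q x = 0" using that Q0 by force
    then show ?thesis using interp[OF that] by (simp add: f'_def)
  qed
  moreover have "f' holomorphic_on UNIV"
    unfolding f'_def by (intro holomorphic_intros f h Q)
  moreover have "f' p = w"
    using F h(2) Q0 by (simp add: f'_def partial_matching_def)
  ultimately have "partial_matching f' F'"
    using fin F'_sub c(2) unfolding partial_matching_def f'_def by blast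
  moreover have "norm (f' z - (f z + h z)) \<le> \<eta>" if "z \<in> cball 0 R" for z
  proof -
    have "norm (f' z - (f z + h z)) = norm c * norm (Q z)"
      by (simp add: f'_def norm_mult)
    also have "\<dots> \<le> \<eta> / C * C"
      using c(1) C \<open>\<eta> > 0\<close> that by (intro mult_mono) auto
    finally show ?thesis using C(1) by simp
  qed
  ultimately show thesis using that unfolding F'_def by blast
qed

text \<open>By density a fresh value \<open>b\<close> can be taken so close to \<open>f a\<close>
  that a small multiple of a function vanishing at \<open>p\<close> and at the old points moves
  \<open>f a\<close> to \<open>b\<close>.\<close>

lemma partial_matching_forth:
  assumes F: "partial_matching f F" and a: "a \<in> A" and "\<epsilon> > 0"
  obtains f' F' where "partial_matching f' F'" "F \<subseteq> F'" "a \<in> fst ` F'"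
    "\<And>z. z \<in> cball 0 R \<Longrightarrow> norm (f' z - f z) \<le> \<epsilon>"
proof (cases "a \<in> fst ` F")
  case True
  then show ?thesis using that[OF F] \<open>\<epsilon> > 0\<close> by simp
next
  case False
  have fin: "finite F" and f: "f holomorphic_on UNIV"
    using F by (auto simp: partial_matching_def)
  obtain P C where P: "P holomorphic_on UNIV" and P0: "\<And>z. P z = 0 \<longleftrightarrow> z \<in> insert p (fst ` F)"
    and C: "C > 0" "\<And>z. z \<in> cball 0 R \<Longrightarrow> norm (P z) \<le> C"
    by (rule entire_function_with_simple_zeros[OF finite.insertI[OF finite_imageI[OF fin]],
          where R = R]) blast
  then have "P a \<noteq> 0" using False a A(1) p by auto
  \<comment> \<open>The radius is chosen so that the correction stays below \<epsilon>/2 on the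
    disc, where \<open>P\<close> is bounded by \<open>C\<close>; the other half is left for the
    generic perturbation.\<close>
  have "finite (snd ` F)" "\<epsilon> / 2 * norm (P a) / C > 0"
    using fin C(1) \<open>\<epsilon> > 0\<close> \<open>P a \<noteq> 0\<close> by auto
  then obtain b where b: "b \<in> B" "b \<notin> snd ` F" "dist (f a) b < \<epsilon> / 2 * norm (P a) / C"
    by (rule dense_avoiding_finite)
  define h where "h = (\<lambda>z. (b - f a) / P a * P z)"
  have h: "h holomorphic_on UNIV"
    unfolding h_def using \<open>P a \<noteq> 0\<close> by (intro holomorphic_intros P)
  have small: "norm (h z) \<le> \<epsilon> / 2" if "z \<in> cball 0 R" for z
  proof -
    have "norm (h z) = dist (f a) b / norm (P a) * norm (P z)"
      by (simp add: h_def norm_mult norm_divide dist_norm norm_minus_commute)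
    also have "\<dots> \<le> (\<epsilon> / 2 * norm (P a) / C) / norm (P a) * C"
      using b(3) C(1) C(2)[OF that] \<open>\<epsilon> > 0\<close> by (intro mult_mono divide_right_mono) auto
    also have "\<dots> = \<epsilon> / 2" using C(1) \<open>P a \<noteq> 0\<close> by simp
    finally show ?thesis .
  qed
  have "h z = 0" if "z \<in> insert p (fst ` F)" for z
    using that P0 by (simp add: h_def)
  moreover have "f a + h a = b" using \<open>P a \<noteq> 0\<close> by (simp add: h_def)
  moreover have "\<epsilon> / 2 > 0" using \<open>\<epsilon> > 0\<close> by simp
  ultimately obtain f' where f': "partial_matching f' (insert (a, b) F)"
    "\<And>z. z \<in> cball 0 R \<Longrightarrow> norm (f' z - (f z + h z)) \<le> \<epsilon> / 2"
    using partial_matching_extend[OF F a b(1) False b(2) h] by blast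
  show ?thesis
  proof (rule that[OF f'(1)])
    fix z :: complex assume z: "z \<in> cball 0 R"
    show "norm (f' z - f z) \<le> \<epsilon>"
      using norm_triangle_ineq[of "f' z - (f z + h z)" "h z"] f'(2)[OF z] small[OF z] by simp
  qed auto
qed

text \<open>The preimage of \<open>b\<close> is placed outside the disc of radius \<open>R\<close>, where the factor
  \<open>(z / a)\<^sup>N\<close> makes the correction small on that disc.\<close>

lemma partial_matching_back:
  assumes F: "partial_matching f F" and b: "b \<in> B" and "\<epsilon> > 0"
  obtains f' F' where "partial_matching f' F'" "F \<subseteq> F'" "b \<in> snd ` F'"
    "\<And>z. z \<in> cball 0 R \<Longrightarrow> norm (f' z - f z) \<le> \<epsilon>"
proof (cases "b \<in> snd ` F")
  case True
  then show ?thesis using that[OF F] \<open>\<epsilon> > 0\<close> by simp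
next
  case False
  have fin: "finite F" and f: "f holomorphic_on UNIV"
    using F by (auto simp: partial_matching_def)
  obtain P C where P: "P holomorphic_on UNIV" and P0: "\<And>z. P z = 0 \<longleftrightarrow> z \<in> insert p (fst ` F)"
    and C: "C > 0" "\<And>z. z \<in> cball 0 R \<Longrightarrow> norm (P z) \<le> C"
    by (rule entire_function_with_simple_zeros[OF finite.insertI[OF finite_imageI[OF fin]],
          where R = R]) blast
  \<comment> \<open>An unbounded \<open>A\<close> has points outside any bounded set. The absolute
    value covers negative \<open>R\<close> and forces \<open>a\<close> to be nonzero.\<close>
  have "bounded (cball 0 \<bar>R\<bar> \<union> fst ` F)"
    using fin by (simp add: finite_imp_bounded)
  then obtain a where a: "a \<in> A" "a \<notin> fst ` F" "norm a > \<bar>R\<bar>"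
    using A(3) by (metis UnI1 UnI2 bounded_subset mem_cball_0 not_le subsetI)
  then have "P a \<noteq> 0" using P0 A(1) p by auto
  define D where "D = norm ((b - f a) / P a) * C"
  have "D \<ge> 0" using C(1) by (simp add: D_def)
  have "\<bar>R\<bar> / norm a < 1" using a(3) by (simp add: divide_less_eq_1)
  then have "(\<lambda>N. D * (\<bar>R\<bar> / norm a) ^ N) \<longlonglongrightarrow> D * 0"
    by (intro tendsto_intros LIMSEQ_power_zero) auto
  then have "\<forall>\<^sub>F N in sequentially. D * (\<bar>R\<bar> / norm a) ^ N < \<epsilon> / 2"
    using \<open>\<epsilon> > 0\<close> by (intro order_tendstoD) auto
  then obtain N where N: "D * (\<bar>R\<bar> / norm a) ^ N < \<epsilon> / 2"
    using eventually_happens by force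
  define h where "h = (\<lambda>z. (b - f a) / P a * P z * (z / a) ^ N)"
  have "a \<noteq> 0" using a(3) by auto
  have h: "h holomorphic_on UNIV"
    unfolding h_def using \<open>P a \<noteq> 0\<close> \<open>a \<noteq> 0\<close> by (intro holomorphic_intros P)
  have small: "norm (h z) \<le> \<epsilon> / 2" if "z \<in> cball 0 R" for z
  proof -
    have "norm (h z) = norm ((b - f a) / P a) * norm (P z) * (norm z / norm a) ^ N"
      by (simp add: h_def norm_mult norm_divide norm_power)
    also have "\<dots> \<le> norm ((b - f a) / P a) * C * (\<bar>R\<bar> / norm a) ^ N"
      using C that by (intro mult_mono power_mono divide_right_mono) auto
    also have "\<dots> \<le> \<epsilon> / 2" using N by (simp add: D_def)
    finally show ?thesis .
  qed
  have "h z = 0" if "z \<in> insert p (fst ` F)" for z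
    using that P0 by (simp add: h_def)
  moreover have "f a + h a = b" using \<open>P a \<noteq> 0\<close> \<open>a \<noteq> 0\<close> by (simp add: h_def)
  moreover have "\<epsilon> / 2 > 0" using \<open>\<epsilon> > 0\<close> by simp
  ultimately obtain f' where f': "partial_matching f' (insert (a, b) F)"
    "\<And>z. z \<in> cball 0 R \<Longrightarrow> norm (f' z - (f z + h z)) \<le> \<epsilon> / 2"
    using partial_matching_extend[OF F a(1) b a(2) False h] by blast
  show ?thesis
  proof (rule that[OF f'(1)])
    fix z :: complex assume z: "z \<in> cball 0 R"
    show "norm (f' z - f z) \<le> \<epsilon>"
      using norm_triangle_ineq[of "f' z - (f z + h z)" "h z"] f'(2)[OF z] small[OF z] by simp
  qed auto
qed

text \<open>Closeness on a disc controls only the compact part of \<open>M\<close> of radius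
  \<open>r\<close>, where the persistence of simple values applies to each of the finitely many
  pairs. The bounds \<open>R\<^sub>0\<close> and \<open>\<epsilon>\<^sub>0\<close> let the
  construction enlarge its discs and shrink its tolerances.\<close>

lemma partial_matching_robust:
  assumes F: "partial_matching f F" and "\<epsilon>\<^sub>0 > 0"
  obtains R \<epsilon> where "R \<ge> R\<^sub>0" "0 < \<epsilon>" "\<epsilon> \<le> \<epsilon>\<^sub>0"
    "\<And>g a b z. g holomorphic_on UNIV \<Longrightarrow> (\<And>a b. (a, b) \<in> F \<Longrightarrow> g a = b) \<Longrightarrow>
      (\<And>z. z \<in> cball 0 R \<Longrightarrow> norm (g z - f z) \<le> \<epsilon>) \<Longrightarrow>
      (a, b) \<in> F \<Longrightarrow> z \<in> M \<Longrightarrow> norm z \<le> r \<Longrightarrow> g z = b \<Longrightarrow> z = a"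
proof -
  have f: "f holomorphic_on UNIV" and fin: "finite F"
    using F by (auto simp: partial_matching_def)
  define K where "K = M \<inter> cball 0 r"
  have K: "compact K" unfolding K_def by (intro closed_Int_compact closed_M compact_cball)
  have "bounded (cball 0 \<bar>r\<bar> \<union> (\<Union>a\<in>fst ` F. cball a 1))"
    using fin by (intro bounded_Un[THEN iffD2] conjI bounded_UN) auto
  \<comment> \<open>Besides the part of \<open>M\<close> in question, the disc must contain the unit
    discs about the matched points, on which persistence requires closeness.\<close>
  then obtain R\<^sub>1 where R1: "cball 0 \<bar>r\<bar> \<union> (\<Union>a\<in>fst ` F. cball a 1) \<subseteq> cball 0 R\<^sub>1"
    by (meson bounded_iff mem_cball_0 subsetI)
  define R where "R = max R\<^sub>0 R\<^sub>1"
  have sub: "K \<union> cball a 1 \<subseteq> cball 0 R" if "(a, b) \<in> F" for a b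
  proof -
    have "K \<subseteq> cball 0 \<bar>r\<bar>" by (auto simp: K_def)
    moreover have "cball a 1 \<subseteq> (\<Union>a\<in>fst ` F. cball a 1)" using that by force
    moreover have "cball 0 R\<^sub>1 \<subseteq> cball (0::complex) R" by (auto simp: R_def)
    ultimately show ?thesis using R1 by blast
  qed
  have "\<forall>\<^sub>F \<epsilon> in at_right 0. \<forall>ab\<in>F. \<forall>g. g holomorphic_on UNIV \<longrightarrow> g (fst ab) = f (fst ab) \<longrightarrow>
    (\<forall>z \<in> K \<union> cball (fst ab) 1. norm (g z - f z) \<le> \<epsilon>) \<longrightarrow>
    (\<forall>z\<in>K. g z = f (fst ab) \<longrightarrow> z = fst ab)"
    (is "\<forall>\<^sub>F \<epsilon> in _. ?P \<epsilon>")
  proof (intro eventually_ball_finite[OF fin] ballI)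
    fix ab assume "ab \<in> F"
    then have "deriv f (fst ab) \<noteq> 0" "\<And>z. z \<in> K \<Longrightarrow> f z = f (fst ab) \<Longrightarrow> z = fst ab"
      using F by (auto simp: partial_matching_def K_def)
    from simple_value_persistent[OF f this(1) K this(2)]
    show "\<forall>\<^sub>F \<epsilon> in at_right 0. \<forall>g. g holomorphic_on UNIV \<longrightarrow> g (fst ab) = f (fst ab) \<longrightarrow>
      (\<forall>z \<in> K \<union> cball (fst ab) 1. norm (g z - f z) \<le> \<epsilon>) \<longrightarrow>
      (\<forall>z\<in>K. g z = f (fst ab) \<longrightarrow> z = fst ab)" .
  qed
  moreover have "\<forall>\<^sub>F \<epsilon> in at_right 0. \<epsilon> \<in> {0<..<\<epsilon>\<^sub>0}"
    using \<open>\<epsilon>\<^sub>0 > 0\<close> by (rule eventually_at_right_real)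
  ultimately have "\<forall>\<^sub>F \<epsilon> in at_right 0. ?P \<epsilon> \<and> \<epsilon> \<in> {0<..<\<epsilon>\<^sub>0}"
    by (rule eventually_conj)
  then have "\<exists>\<epsilon>. ?P \<epsilon> \<and> \<epsilon> \<in> {0<..<\<epsilon>\<^sub>0}"
    by (rule eventually_happens'[OF trivial_limit_at_right_real])
  then obtain \<epsilon> where \<epsilon>: "?P \<epsilon>" and "\<epsilon> \<in> {0<..<\<epsilon>\<^sub>0}"
    by blast
  show thesis
  proof (rule that[of R \<epsilon>])
    fix g a b z
    assume g: "g holomorphic_on UNIV" "\<And>a b. (a, b) \<in> F \<Longrightarrow> g a = b"
      "\<And>z. z \<in> cball 0 R \<Longrightarrow> norm (g z - f z) \<le> \<epsilon>"
      and ab: "(a, b) \<in> F" and z: "z \<in> M" "norm z \<le> r" "g z = b"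
    have "f a = b" using F ab by (auto simp: partial_matching_def)
    moreover have "z \<in> K" using z by (simp add: K_def)
    moreover have "\<forall>z \<in> K \<union> cball a 1. norm (g z - f z) \<le> \<epsilon>"
      using g(3) sub[OF ab] by blast
    ultimately show "z = a"
      using bspec[OF \<epsilon> ab] g(1) g(2)[OF ab] z(3) by simp
  qed (use \<open>\<epsilon> \<in> {0<..<\<epsilon>\<^sub>0}\<close> in \<open>auto simp: R_def\<close>)
qed

lemma matching_entire_function_exists:
  obtains f where "f holomorphic_on UNIV" "f p = w" "bij_betw f A B" "f -` B \<inter> M = A"
proof -
  have "A \<noteq> {}" using A(3) by auto
  then have ran_A: "range (from_nat_into A) = A"
    using A(2) by (rule range_from_nat_into)
  have "B \<noteq> {}" using B(2) by auto
  then have ran_B: "range (from_nat_into B) = B"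
    using B(1) by (rule range_from_nat_into)
  define near where "near f R \<epsilon> g \<longleftrightarrow> (\<forall>z\<in>cball 0 R. norm (g z - f z) \<le> \<epsilon>)"
    for f g :: "complex \<Rightarrow> complex" and R \<epsilon> :: real
  \<comment> \<open>The last clause speaks of every entire \<open>g\<close> within the tolerance, so
    that it can finally be applied to the limit. The bounds on \<open>R\<close> and \<epsilon> yield
    locally uniform convergence.\<close>
  define inv where "inv n f F R \<epsilon> \<longleftrightarrow> partial_matching f F \<and> real n \<le> R \<and> 0 < \<epsilon> \<and> \<epsilon> \<le> (1/2) ^ n \<and>
    (\<forall>g. g holomorphic_on UNIV \<longrightarrow> (\<forall>(a, b)\<in>F. g a = b) \<longrightarrow> near f R \<epsilon> g \<longrightarrow>
      (\<forall>(a, b)\<in>F. \<forall>z\<in>M. norm z \<le> real n \<longrightarrow> g z = b \<longrightarrow> z = a))"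
    for n f F R \<epsilon>
  \<comment> \<open>A step spends half of the tolerance and the next tolerance is at most the other
    half, so all later functions stay within the original one.\<close>
  define step where "step n f F R \<epsilon> f' F' R' \<epsilon>' \<longleftrightarrow> F \<subseteq> F' \<and> from_nat_into A n \<in> fst ` F' \<and>
    from_nat_into B n \<in> snd ` F' \<and> R \<le> R' \<and> \<epsilon>' \<le> \<epsilon> / 2 \<and> near f R (\<epsilon> / 2) f'"
    for n f F R \<epsilon> f' F' R' \<epsilon>'
  have robust: "\<exists>R \<epsilon>. inv n f F R \<epsilon> \<and> R\<^sub>0 \<le> R \<and> \<epsilon> \<le> \<epsilon>\<^sub>0"
    if F: "partial_matching f F" and "0 < \<epsilon>\<^sub>0" for n f F R\<^sub>0 \<epsilon>\<^sub>0
  proof -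
    have min: "0 < min \<epsilon>\<^sub>0 ((1/2) ^ n)" using that by simp
    obtain R \<epsilon> where R: "R \<ge> max R\<^sub>0 (real n)" "0 < \<epsilon>" "\<epsilon> \<le> min \<epsilon>\<^sub>0 ((1/2) ^ n)"
      and rob: "\<And>g a b z. g holomorphic_on UNIV \<Longrightarrow> (\<And>a b. (a, b) \<in> F \<Longrightarrow> g a = b) \<Longrightarrow>
        (\<And>z. z \<in> cball 0 R \<Longrightarrow> norm (g z - f z) \<le> \<epsilon>) \<Longrightarrow>
        (a, b) \<in> F \<Longrightarrow> z \<in> M \<Longrightarrow> norm z \<le> real n \<Longrightarrow> g z = b \<Longrightarrow> z = a"
      by (rule partial_matching_robust[OF F min, where R\<^sub>0 = "max R\<^sub>0 (real n)" and r = "real n"]) blast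
    have "z = a" if "g holomorphic_on UNIV" "\<forall>(a, b)\<in>F. g a = b" "near f R \<epsilon> g"
      "(a, b) \<in> F" "z \<in> M" "norm z \<le> real n" "g z = b" for g a b z
      by (rule rob[OF that(1) _ _ that(4-7)]) (use that(2,3) in \<open>auto simp: near_def\<close>)
    then have "inv n f F R \<epsilon>"
      unfolding inv_def using F R by auto
    then show ?thesis using R by auto
  qed
  define good where "good n s \<longleftrightarrow> (case s of (f, F, R, \<epsilon>) \<Rightarrow> inv n f F R \<epsilon>)" for n s
  define next_good where "next_good n s t \<longleftrightarrow> (case s of (f, F, R, \<epsilon>) \<Rightarrow>
    case t of (f', F', R', \<epsilon>') \<Rightarrow> step n f F R \<epsilon> f' F' R' \<epsilon>')" for n s t

  \<comment> \<open>Recursive construction of the approximations\<close>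
  have "\<exists>s. \<forall>n. good n (s n) \<and> next_good n (s n) (s (Suc n))"
  proof (rule dependent_nat_choice)
    \<comment> \<open>The start is the constant \<open>w\<close>: it has the prescribed value at
      \<open>p\<close>, and an empty matching imposes nothing.\<close>
    have "partial_matching (\<lambda>_. w) {}"
      by (simp add: partial_matching_def)
    then obtain R \<epsilon> where "inv 0 (\<lambda>_. w) {} R \<epsilon>"
      using robust[of "\<lambda>_. w" "{}" 1 0 0] by auto
    then show "\<exists>s. good 0 s"
      by (auto simp: good_def)
  next
    fix s :: "(complex \<Rightarrow> complex) \<times> (complex \<times> complex) set \<times> real \<times> real" and n
    obtain f F R \<epsilon> where s: "s = (f, F, R, \<epsilon>)" by (metis prod_cases4)
    assume "good n s"
    then have inv: "partial_matching f F" "0 < \<epsilon>" by (auto simp: s good_def inv_def)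
    \<comment> \<open>One quarter each for the forth and the back move makes up the permitted
      \<epsilon>/2.\<close>
    then have \<epsilon>: "0 < \<epsilon> / 4" by simp
    obtain f1 F1 where 1: "partial_matching f1 F1" "F \<subseteq> F1" "from_nat_into A n \<in> fst ` F1"
      "\<And>z. z \<in> cball 0 R \<Longrightarrow> norm (f1 z - f z) \<le> \<epsilon> / 4"
      using partial_matching_forth[OF inv(1) from_nat_into[OF \<open>A \<noteq> {}\<close>] \<epsilon>] by metis
    obtain f2 F2 where 2: "partial_matching f2 F2" "F1 \<subseteq> F2" "from_nat_into B n \<in> snd ` F2"
      "\<And>z. z \<in> cball 0 R \<Longrightarrow> norm (f2 z - f1 z) \<le> \<epsilon> / 4"
      using partial_matching_back[OF 1(1) from_nat_into[OF \<open>B \<noteq> {}\<close>] \<epsilon>] by metis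
    have "near f R (\<epsilon> / 2) f2"
      unfolding near_def
    proof
      fix z :: complex assume z: "z \<in> cball 0 R"
      show "norm (f2 z - f z) \<le> \<epsilon> / 2"
        using norm_triangle_ineq[of "f2 z - f1 z" "f1 z - f z"] 1(4)[OF z] 2(4)[OF z] by simp
    qed
    moreover obtain R' \<epsilon>' where "inv (Suc n) f2 F2 R' \<epsilon>'" "R \<le> R'" "\<epsilon>' \<le> \<epsilon> / 2"
      using robust[OF 2(1), of "\<epsilon> / 2" "Suc n" R] inv(2) by auto
    ultimately have "inv (Suc n) f2 F2 R' \<epsilon>' \<and> step n f F R \<epsilon> f2 F2 R' \<epsilon>'"
      using 1(2,3) 2(2,3) by (auto simp: step_def)
    then show "\<exists>t. good (Suc n) t \<and> next_good n s t"
      by (intro exI[of _ "(f2, F2, R', \<epsilon>')"]) (simp add: s good_def next_good_def)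
  qed
  then obtain s where s: "\<And>n. good n (s n)" "\<And>n. next_good n (s n) (s (Suc n))"
    by blast
  define f where "f n = fst (s n)" for n
  define F where "F n = fst (snd (s n))" for n
  define R where "R n = fst (snd (snd (s n)))" for n
  define \<epsilon> where "\<epsilon> n = snd (snd (snd (s n)))" for n
  note defs = f_def F_def R_def \<epsilon>_def
  have inv: "inv n (f n) (F n) (R n) (\<epsilon> n)" for n
    using s(1)[of n] by (simp add: defs good_def case_prod_beta)
  have steps: "step n (f n) (F n) (R n) (\<epsilon> n) (f (Suc n)) (F (Suc n)) (R (Suc n)) (\<epsilon> (Suc n))" for n
    using s(2)[of n] by (simp add: defs next_good_def case_prod_beta)
  have pm: "partial_matching (f n) (F n)" for n using inv[of n] by (simp add: inv_def)
  have hol: "f n holomorphic_on UNIV" for n using pm[of n] by (simp add: partial_matching_def)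
  have F_mono: "F m \<subseteq> F n" if "m \<le> n" for m n
    using steps by (intro lift_Suc_mono_le[OF _ that]) (auto simp: step_def)
  \<comment> \<open>Descending from stage \<open>k\<close> to stage \<open>n\<close>, the tolerances
    telescope while the discs shrink.\<close>
  have near_mono: "near (f n) (R n) (\<epsilon> n) g" if "n \<le> k" "near (f k) (R k) (\<epsilon> k) g" for n k g
    using that
  proof (induction rule: dec_induct)
    case (step k)
    have st: "R k \<le> R (Suc k)" "\<epsilon> (Suc k) \<le> \<epsilon> k / 2" "near (f k) (R k) (\<epsilon> k / 2) (f (Suc k))"
      using steps[of k] by (auto simp: step_def)
    have "near (f k) (R k) (\<epsilon> k) g"
      unfolding near_def
    proof
      fix z :: complex assume z: "z \<in> cball 0 (R k)"
      have "norm (f (Suc k) z - f k z) \<le> \<epsilon> k / 2"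
        using st(3) z by (simp add: near_def)
      moreover have "norm (g z - f (Suc k) z) \<le> \<epsilon> (Suc k)"
        using step.prems st(1) z by (simp add: near_def)
      ultimately show "norm (g z - f k z) \<le> \<epsilon> k"
        using norm_triangle_ineq[of "g z - f (Suc k) z" "f (Suc k) z - f k z"] st(2) by simp
    qed
    then show ?case by (rule step.IH)
  qed
  have near_f: "near (f n) (R n) (\<epsilon> n) (f k)" if "n \<le> k" for n k
    using that inv[of k] by (intro near_mono[of n k]) (auto simp: near_def inv_def)
  have close: "norm (f k z - f n z) \<le> (1/2) ^ n" if "n \<le> k" "norm z \<le> real n" for n k z
  proof -
    have "norm z \<le> R n" "\<epsilon> n \<le> (1/2) ^ n" using that(2) inv[of n] by (simp_all add: inv_def)
    moreover from this have "norm (f k z - f n z) \<le> \<epsilon> n"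
      using near_f[OF that(1)] by (simp add: near_def)
    ultimately show ?thesis by simp
  qed
  have conv: "convergent (\<lambda>k. f k z)" for z
  proof (rule Cauchy_convergent, rule metric_CauchyI)
    fix e :: real assume "e > 0"
    have "(\<lambda>n. (1/2 :: real) ^ n) \<longlonglongrightarrow> 0" by (rule LIMSEQ_power_zero) simp
    then have "\<forall>\<^sub>F n in sequentially. (1/2 :: real) ^ n < e / 2"
      using \<open>e > 0\<close> by (intro order_tendstoD) auto
    moreover have "\<forall>\<^sub>F n in sequentially. norm z \<le> real n"
      using filterlim_real_sequentially by (simp add: filterlim_at_top)
    ultimately have "\<forall>\<^sub>F n in sequentially. (1/2 :: real) ^ n < e / 2 \<and> norm z \<le> real n"
      by (rule eventually_conj)
    then obtain N where N: "(1/2 :: real) ^ N < e / 2" "norm z \<le> real N"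
      using eventually_happens by force
    have "dist (f m z) (f n z) < e" if "m \<ge> N" "n \<ge> N" for m n
      using close[OF that(1) N(2)] close[OF that(2) N(2)] N(1)
        dist_triangle3[of "f m z" "f n z" "f N z"]
      by (simp add: dist_norm norm_minus_commute)
    then show "\<exists>N. \<forall>m\<ge>N. \<forall>n\<ge>N. dist (f m z) (f n z) < e" by blast
  qed

  \<comment> \<open>The limit function\<close>
  define g where "g z = lim (\<lambda>k. f k z)" for z
  have lim: "(\<lambda>k. f k z) \<longlonglongrightarrow> g z" for z
    using conv by (simp add: g_def convergent_LIMSEQ_iff)
  \<comment> \<open>The non-strict estimates pass to the limit, so \<open>g\<close> qualifies for
    the last clause of \<open>inv\<close> at every stage once it is known to be entire and to
    respect the matchings.\<close>
  have near_g: "near (f n) (R n) (\<epsilon> n) g" for n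
    unfolding near_def
  proof
    fix z :: complex assume z: "z \<in> cball 0 (R n)"
    have "(\<lambda>k. f k z - f n z) \<longlonglongrightarrow> g z - f n z"
      by (intro tendsto_intros lim)
    moreover have "\<forall>\<^sub>F k in sequentially. norm (f k z - f n z) \<le> \<epsilon> n"
      using near_f z unfolding near_def by (auto intro!: eventually_sequentiallyI[of n])
    ultimately show "norm (g z - f n z) \<le> \<epsilon> n"
      by (rule Lim_norm_ubound[OF sequentially_bot])
  qed
  have close_g: "norm (g z - f n z) \<le> (1/2) ^ n" if "norm z \<le> real n" for n z
  proof -
    have "norm z \<le> R n" "\<epsilon> n \<le> (1/2) ^ n" using that inv[of n] by (simp_all add: inv_def)
    moreover from this have "norm (g z - f n z) \<le> \<epsilon> n"
      using near_g[of n] by (simp add: near_def)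
    ultimately show ?thesis by simp
  qed
  \<comment> \<open>Matched pairs persist in all later matchings, so the values at \<open>a\<close>
    are constant from stage \<open>n\<close> on.\<close>
  have g_eq: "g a = b" if "(a, b) \<in> F n" for a b n
  proof (rule LIMSEQ_unique[OF lim])
    have "f k a = b" if "k \<ge> n" for k
      using F_mono[OF that] \<open>(a, b) \<in> F n\<close> partial_matchingD(1)[OF pm] by blast
    then show "(\<lambda>k. f k a) \<longlonglongrightarrow> b"
      by (intro tendsto_eventually eventually_sequentiallyI)
  qed
  have g_hol: "g holomorphic_on UNIV"
  proof (rule holomorphic_uniform_sequence[OF open_UNIV hol])
    fix x :: complex
    have "uniform_limit (cball x 1) f g sequentially"
      unfolding uniform_limit_iff
    proof (intro allI impI)
      fix e :: real assume "e > 0"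
      have "(\<lambda>n. (1/2 :: real) ^ n) \<longlonglongrightarrow> 0" by (rule LIMSEQ_power_zero) simp
      then have "\<forall>\<^sub>F n in sequentially. (1/2 :: real) ^ n < e"
        using \<open>e > 0\<close> by (intro order_tendstoD) auto
      moreover have "\<forall>\<^sub>F n in sequentially. norm x + 1 \<le> real n"
        using filterlim_real_sequentially by (simp add: filterlim_at_top)
      ultimately show "\<forall>\<^sub>F n in sequentially. \<forall>z\<in>cball x 1. dist (f n z) (g z) < e"
      proof eventually_elim
        case (elim n)
        show ?case
        proof
          fix z assume "z \<in> cball x 1"
          then have "norm z \<le> real n"
            using elim(2) norm_triangle_ineq[of x "z - x"] by (simp add: dist_norm norm_minus_commute)
          then have "norm (g z - f n z) \<le> (1/2) ^ n"
            by (rule close_g)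
          then show "dist (f n z) (g z) < e"
            using elim(1) by (simp add: dist_norm norm_minus_commute)
        qed
      qed
    qed
    then show "\<exists>d>0. cball x d \<subseteq> UNIV \<and> uniform_limit (cball x d) f g sequentially"
      by (intro exI[of _ 1]) auto
  qed

  \<comment> \<open>Bijectivity and preimages in M\<close>
  have unique: "z = a" if "(a, b) \<in> F n" "z \<in> M" "g z = b" for a b n z
  proof -
    \<comment> \<open>A stage that already contains the pair and whose radius of guaranteed
      uniqueness reaches \<open>z\<close>.\<close>
    obtain m where m: "n \<le> m" "norm z \<le> real m"
      by (meson linear order_trans of_nat_mono real_arch_simple)
    have "(a, b) \<in> F m" using F_mono[OF m(1)] that(1) by blast
    moreover have "\<forall>(a, b)\<in>F m. g a = b" using g_eq by blast
    ultimately show ?thesis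
      using inv[of m] g_hol near_g[of m] that(2,3) m(2) unfolding inv_def by blast
  qed
  have dom: "\<exists>n b. (a, b) \<in> F n" if a: "a \<in> A" for a
  proof -
    obtain n where "a = from_nat_into A n" using a ran_A by blast
    \<comment> \<open>Element number \<open>n\<close> is treated in passing from stage
      \<open>n\<close> to the next, hence the successor.\<close>
    then have "a \<in> fst ` F (Suc n)" using steps[of n] by (simp add: step_def)
    then show ?thesis by force
  qed
  have cod: "\<exists>n a. (a, b) \<in> F n" if b: "b \<in> B" for b
  proof -
    obtain n where "b = from_nat_into B n" using b ran_B by blast
    then have "b \<in> snd ` F (Suc n)" using steps[of n] by (simp add: step_def)
    then show ?thesis by force
  qed
  note FAB = partial_matchingD(2,3)[OF pm]
  have maps: "g a \<in> B" if "a \<in> A" for a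
    using dom[OF that] g_eq FAB(2) by metis
  have onto: "b \<in> g ` A" if "b \<in> B" for b
    using cod[OF that] g_eq FAB(1) by (metis image_eqI)
  have preimage: "z \<in> A" if "z \<in> M" "g z \<in> B" for z
    using cod[OF that(2)] unique[OF _ that(1) refl] FAB(1) by metis
  show thesis
  proof (rule that[OF g_hol])
    have "f k p = w" for k using pm[of k] by (simp add: partial_matching_def)
    then show "g p = w" using LIMSEQ_unique[OF lim[of p]] by simp
    show "bij_betw g A B"
      unfolding bij_betw_def
    proof
      show "inj_on g A"
      proof (rule inj_onI)
        fix x y assume "x \<in> A" "y \<in> A" "g x = g y"
        moreover from this obtain n b where "(y, b) \<in> F n" using dom by blast
        ultimately show "x = y" using unique g_eq A(1) by blast
      qed
      show "g ` A = B" using maps onto by auto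
    qed
    show "g -` B \<inter> M = A"
      using maps preimage A(1) by auto
  qed
qed

end

section \<open>Existence and cardinality\<close>

theorem proposition2p8:
  fixes M A B :: "complex set"
  assumes "closed M" and "\<not> bounded M" and "M \<in> null_sets lborel"
    and "A \<subseteq> M" and "countable A" and "dense_in (top_of_set M) A"
    and "countable B" and "dense_in euclidean B"
  shows "(\<exists>f. transcendental_entire f \<and> bij_betw f A B \<and> f -` B \<inter> M = A) \<and>
    {f. transcendental_entire f \<and> bij_betw f A B \<and> f -` B \<inter> M = A} \<approx> (UNIV :: real set)"
proof -
  define S where "S = {f. transcendental_entire f \<and> bij_betw f A B \<and> f -` B \<inter> M = A}"
  have null: "negligible M"
    using assms(3) by (simp add: negligible_iff_null_sets null_sets_completionI)
  then obtain p where p: "p \<notin> M"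
    by (metis UNIV_eq_I non_negligible_UNIV)
  \<comment> \<open>Density places \<open>M\<close> inside the closure of \<open>A\<close>; a
    bounded \<open>A\<close> would make \<open>M\<close> bounded.\<close>
  have "M \<inter> closure (M \<inter> A) = M"
    using assms(6) by (simp add: dense_in_def closure_of_subtopology)
  then have "M \<subseteq> closure A"
    using closure_mono[of "M \<inter> A" A] by blast
  then have unbounded_A: "\<not> bounded A"
    using assms(2) bounded_closure bounded_subset by blast
  have dense_B: "closure B = UNIV"
    using assms(8) by (simp add: dense_in_def)
  have ex: "\<exists>f\<in>S. f p = w" for w
  proof -
    interpret back_and_forth M A B p w
      using assms null p unbounded_A dense_B by unfold_locales auto
    obtain f where f: "f holomorphic_on UNIV" "f p = w" "bij_betw f A B" "f -` B \<inter> M = A"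
      by (rule matching_entire_function_exists)
    have "f \<noteq> poly q" for q
      using polynomial_image_negligible_not_dense[OF assms(1) null dense_B, of q] f(3) assms(4)
      by (auto simp: bij_betw_def)
    then have "f \<in> S" using f by (auto simp: S_def transcendental_entire_def)
    with f(2) show ?thesis by blast
  qed
  then obtain \<phi> where \<phi>: "\<And>w. \<phi> w \<in> S" "\<And>w. \<phi> w p = w" by metis
  \<comment> \<open>Solutions with different prescribed values at \<open>p\<close> are different,
    which gives the lower bound; the upper bound comes from counting continuous functions.\<close>
  have "inj (\<lambda>x :: real. \<phi> (of_real x))"
    by (metis (mono_tags, lifting) \<phi>(2) injI of_real_eq_iff)
  then have "(UNIV :: real set) \<lesssim> S"
    unfolding lepoll_def using \<phi>(1) by blast
  moreover have "S \<lesssim> (UNIV :: real set)"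
  proof -
    have "S \<subseteq> {f. continuous_on UNIV f}"
      by (auto simp: S_def transcendental_entire_def holomorphic_on_imp_continuous_on)
    then have "S \<lesssim> {f :: complex \<Rightarrow> complex. continuous_on UNIV f}"
      by (rule subset_imp_lepoll)
    also have "\<dots> \<lesssim> (UNIV :: nat set set)"
      by (rule continuous_functions_lepoll_nat_sets)
    also have "\<dots> \<approx> (UNIV :: real set)"
      by (rule nat_sets_eqpoll_reals)
    finally show ?thesis .
  qed
  ultimately have "S \<approx> (UNIV :: real set)"
    by (simp add: lepoll_antisym)
  moreover have "\<exists>f. f \<in> S" using ex by blast
  ultimately show ?thesis by (simp add: S_def)
qed

end
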